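(* Let $A\in DN(n,3)$ with $|\operatorname{Extr}(C_A)|=3$. Then $A\in CP(n,3)$ if and only if $A$ is nnq.
   Context: All matrices are real. An $n\times n$ matrix $A$ is doubly nonnegative if it is symmetric positive semidefinite and all its entries are nonnegative. $DN(n,r)$ is the set of all $n\times n$ doubly nonnegative matrices of rank $r$. An $n\times n$ matrix $A$ is completely positive if $A=B^TB$ for some entrywise nonnegative $B\in\mathbb{R}^{m\times n}$ (for some $m$); the minimum such $m$ is called the cp-rank of $A$. $CP(n,r)$ is the set of all $n\times n$ completely positive matrices $A$ with $\text{cp-rank}(A)=\operatorname{rank}(A)=r$. It is assumed throughout that $0<r\le n$. $C_A$ denotes the convex cone generated by the columns of $A$, and $\operatorname{Extr}(C)$ denotes the set of all extreme rays of a cone $C$. An $r\times n$ matrix $B$ with $r=\operatorname{rank}(B)\le n$ is called nnq (nonnegative equivalent) if there is a nonsingular $r\times r$ submatrix $B_1$ of $B$ (formed by $r$ of its columns) such that $B_1^{-1}B\ge 0$ entrywise. An $n\times n$ symmetric matrix $A$ with $\operatorname{rank}(A)=r$ is called nnq if $A$ has an $r\times n$ submatrix (formed by $r$ of its rows) that is nnq. *)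

theory Defs
  imports
    "Jordan_Normal_Form.DL_Rank"
    "Jordan_Normal_Form.DL_Submatrix"
    Complex_Main
begin

text \<open>The order on \<^typ>\<open>real mat\<close> and \<^typ>\<open>real vec\<close> is the library's entrywise order, which
  relates only objects of equal dimensions.\<close>

abbreviation mat_rank :: "real mat \<Rightarrow> nat" where
  "mat_rank A \<equiv> vec_space.rank (dim_row A) A"

definition symmetric_matrix :: "real mat \<Rightarrow> bool" where
  "symmetric_matrix A \<longleftrightarrow> square_mat A \<and> A\<^sup>T = A"

definition pos_semidef :: "real mat \<Rightarrow> bool" where
  "pos_semidef A \<longleftrightarrow> symmetric_matrix A \<and> (\<forall>x \<in> carrier_vec (dim_row A). 0 \<le> x \<bullet> (A *\<^sub>v x))"

definition nonneg_matrix :: "real mat \<Rightarrow> bool" where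
  "nonneg_matrix A \<longleftrightarrow> 0\<^sub>m (dim_row A) (dim_col A) \<le> A"

definition DN :: "nat \<Rightarrow> nat \<Rightarrow> real mat set" where
  "DN n r = {A \<in> carrier_mat n n. pos_semidef A \<and> nonneg_matrix A \<and> mat_rank A = r}"

definition cp_factor :: "nat \<Rightarrow> real mat \<Rightarrow> real mat \<Rightarrow> bool" where
  "cp_factor m A B \<longleftrightarrow> B \<in> carrier_mat m (dim_col A) \<and> nonneg_matrix B \<and> A = B\<^sup>T * B"

definition completely_positive :: "real mat \<Rightarrow> bool" where
  "completely_positive A \<longleftrightarrow> (\<exists>m B. cp_factor m A B)"

text \<open>Meaningful only for completely positive matrices; \<open>LEAST\<close> is unspecified otherwise.\<close>

definition cp_rank :: "real mat \<Rightarrow> nat" where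
  "cp_rank A = (LEAST m. \<exists>B. cp_factor m A B)"

definition CP :: "nat \<Rightarrow> nat \<Rightarrow> real mat set" where
  "CP n r = {A \<in> carrier_mat n n. completely_positive A \<and> cp_rank A = r \<and> mat_rank A = r}"

text \<open>\<^term>\<open>A *\<^sub>v x\<close> is the combination of the columns of \<open>A\<close> with the coefficients \<open>x\<close>.\<close>

definition column_cone :: "real mat \<Rightarrow> real vec set" where
  "column_cone A = {A *\<^sub>v x | x. x \<in> carrier_vec (dim_col A) \<and> 0\<^sub>v (dim_col A) \<le> x}"

definition ray :: "real vec \<Rightarrow> real vec set" where
  "ray x = {t \<cdot>\<^sub>v x | t. 0 \<le> t}"

text \<open>The elements are the rays themselves, not generators, so that cardinality counts
  extreme rays.\<close>

definition Extr :: "real vec set \<Rightarrow> real vec set set" where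
  "Extr C = {R. R \<subseteq> C \<and> (\<exists>x. x \<noteq> 0\<^sub>v (dim_vec x) \<and> R = ray x) \<and>
     (\<forall>y \<in> C. \<forall>z \<in> C. y + z \<in> R \<longrightarrow> y \<in> R \<and> z \<in> R)}"

text \<open>Two notions share the name nnq: one for \<open>r \<times> n\<close> matrices of full row rank, one for
  symmetric matrices. Below, \<open>J\<close> selects columns and \<open>I\<close> selects rows; \<open>C\<close> is the inverse of
  the selected square submatrix.\<close>

definition nnq_full_row_rank :: "real mat \<Rightarrow> bool" where
  "nnq_full_row_rank B \<longleftrightarrow> mat_rank B = dim_row B \<and>
     (\<exists>J C. J \<subseteq> {..<dim_col B} \<and> card J = dim_row B \<and>
        C \<in> carrier_mat (dim_row B) (dim_row B) \<and>
        inverts_mat (submatrix B UNIV J) C \<and> inverts_mat C (submatrix B UNIV J) \<and>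
        nonneg_matrix (C * B))"

definition nnq :: "real mat \<Rightarrow> bool" where
  "nnq A \<longleftrightarrow> symmetric_matrix A \<and>
     (\<exists>I. I \<subseteq> {..<dim_row A} \<and> card I = mat_rank A \<and> nnq_full_row_rank (submatrix A I UNIV))"

end

theory Submission
  imports Defs "Jordan_Normal_Form.DL_Rank_Submatrix"
begin

text \<open>For these matrices both sides of the equivalence hold. The cone of the columns of a
  nonnegative matrix \<open>A\<close> is generated by its extreme rays, and every extreme ray contains a
  column. If there are only as many extreme rays as the rank \<open>r\<close>, then \<open>r\<close> columns, with index
  set \<open>J\<close>, generate the cone: \<open>A = A[*,J] P\<close> with a nonnegative \<open>P\<close> (lemma
  \<open>simplicial_column_factorization\<close>). Symmetry of \<open>A\<close> turns this into
  \<open>A = P\<^sup>T A[J,J] P\<close> and \<open>A[J,*] = A[J,J] P\<close>, and the rank forces \<open>A[J,J]\<close> to be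
  nonsingular.

  Nonnegative equivalence can now be read off: \<open>A[J,J]\<close> is a nonsingular block of the rows
  \<open>A[J,*]\<close>, and multiplying these rows by its inverse gives the nonnegative matrix \<open>P\<close> (lemma
  \<open>nnq_of_column_factorization\<close>).

  For complete positivity, \<open>A[J,J]\<close> is doubly nonnegative. In order three this already implies a
  factorization \<open>A[J,J] = B\<^sup>T B\<close> with a nonnegative \<open>B\<close> of order three (lemma
  \<open>dnn_order_3_factor\<close>), because some diagonal entry can be eliminated with a
  nonnegative Schur complement. Then \<open>A = (B P)\<^sup>T (B P)\<close> shows that the cp-rank is at most
  three, and it is never smaller than the rank.\<close>

section \<open>Selecting rows and columns\<close>

lemma bij_betw_pick:
  assumes "finite J"
  shows "bij_betw (pick J) {..<card J} J"
proof -
  have inj: "inj_on (pick J) {..<card J}"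
    by (rule linorder_inj_onI) (metis lessThan_iff less_irrefl pick_mono_le, auto)
  have "pick J ` {..<card J} \<subseteq> J"
    using pick_in_set_le by auto
  moreover have "card (pick J ` {..<card J}) = card J"
    using inj by (simp add: card_image)
  ultimately show ?thesis
    using inj assms by (simp add: bij_betw_def card_subset_eq)
qed

lemma selected_eq:
  assumes "J \<subseteq> {..<m}"
  shows "{i. i < m \<and> i \<in> J} = J"
  using assms by auto

lemma transpose_submatrix: "(submatrix A I J)\<^sup>T = submatrix (A\<^sup>T) J I"
  by (rule eq_matI) (auto simp: submatrix_def pick_le)

lemma submatrix_rows_mult:
  assumes "X \<in> carrier_mat n m" "Y \<in> carrier_mat m k"
  shows "submatrix (X * Y) I UNIV = submatrix X I UNIV * Y"
proof (rule eq_matI)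
  fix i j
  assume "i < dim_row (submatrix X I UNIV * Y)" and j: "j < dim_col (submatrix X I UNIV * Y)"
  hence i: "i < card {i. i < dim_row X \<and> i \<in> I}"
    by (simp add: dim_submatrix)
  have "submatrix (X * Y) I UNIV $$ (i, j) = (X * Y) $$ (pick I i, j)"
    using i j assms by (subst submatrix_index) (auto simp: pick_UNIV)
  also have "\<dots> = (submatrix X I UNIV * Y) $$ (i, j)"
    using i j assms pick_le[OF i] by (simp add: row_submatrix_UNIV dim_submatrix)
  finally show "submatrix (X * Y) I UNIV $$ (i, j) = (submatrix X I UNIV * Y) $$ (i, j)" .
qed (use assms in \<open>auto simp: dim_submatrix\<close>)

lemma submatrix_rows_then_cols:
  "submatrix (submatrix A I UNIV) UNIV J = submatrix A I J"
  by (rule eq_matI) (auto simp: submatrix_def pick_UNIV pick_le)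

text \<open>The factorization \<open>A = A[*,J] P\<close> restricts to the rows in \<open>J\<close>. By symmetry \<open>A[*,J]\<close> is the
  transpose of \<open>A[J,*] = A[J,J] P\<close>, so it can be replaced by \<open>P\<^sup>T A[J,J]\<close>.\<close>

lemma gram_form_of_column_factorization:
  fixes A P :: "'a :: comm_semiring_0 mat"
  assumes A: "A \<in> carrier_mat n n" and sym: "A\<^sup>T = A"
    and P: "P \<in> carrier_mat (card J) n" and J: "J \<subseteq> {..<n}"
    and eq: "A = submatrix A UNIV J * P"
  shows "submatrix A J UNIV = submatrix A J J * P"
    and "A = P\<^sup>T * submatrix A J J * P"
proof -
  have carr: "submatrix A UNIV J \<in> carrier_mat n (card J)"
      "submatrix A J J \<in> carrier_mat (card J) (card J)"
    using A by (auto simp: dim_submatrix selected_eq[OF J])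
  have "submatrix A J UNIV = submatrix (submatrix A UNIV J * P) J UNIV"
    using eq by simp
  also have "\<dots> = submatrix A J J * P"
    using submatrix_rows_mult[OF carr(1) P] submatrix_split[of A J J] by simp
  finally show rows: "submatrix A J UNIV = submatrix A J J * P" .
  have "submatrix A UNIV J = (submatrix A J UNIV)\<^sup>T"
    by (simp add: transpose_submatrix sym)
  also have "\<dots> = P\<^sup>T * submatrix A J J"
    unfolding rows by (simp add: transpose_mult[OF carr(2) P] transpose_submatrix sym)
  finally show "A = P\<^sup>T * submatrix A J J * P"
    using eq by simp
qed

section \<open>Rank of products\<close>

text \<open>Each column of \<open>X Y\<close> is a combination of columns of \<open>X\<close>, so the column spaces are nested.\<close>

lemma (in vec_space) rank_mult_le_left:
  assumes X: "X \<in> carrier_mat n m" and Y: "Y \<in> carrier_mat m k"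
  shows "rank (X * Y) \<le> rank X"
proof -
  let ?U = "span (set (cols (X * Y)))" and ?W = "span (set (cols X))"
  have cX: "set (cols X) \<subseteq> carrier_vec n" and cXY: "set (cols (X * Y)) \<subseteq> carrier_vec n"
    using cols_dim X Y by (metis carrier_matD(1), metis carrier_matD(1) mult_carrier_mat)
  have "set (cols (X * Y)) \<subseteq> ?W"
  proof
    fix v assume "v \<in> set (cols (X * Y))"
    then obtain j where "j < k" and v: "v = col (X * Y) j"
      using X Y by (auto simp: cols_def)
    hence "v = X *\<^sub>v col Y j"
      using X Y by auto
    also have "\<dots> = lincomb_list (\<lambda>l. col Y j $ l) (cols X)"
    proof -
      have "vec (length (cols X)) (\<lambda>l. col Y j $ l) = col Y j"
        using X Y by auto
      moreover have "mat_of_cols n (cols X) = X"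
        using X by auto
      moreover have "\<forall>w\<in>set (cols X). dim_vec w = n"
        using cX by (metis carrier_vecD subsetD)
      ultimately show ?thesis
        using lincomb_list_as_mat_mult[of "cols X" "\<lambda>l. col Y j $ l"] by simp
    qed
    also have "\<dots> \<in> ?W"
      using cX span_list_as_span in_span_listI by blast
    finally show "v \<in> ?W" .
  qed
  hence sub: "?U \<subseteq> ?W"
    using cX by (rule span_subsetI[rotated])
  have W: "VectorSpace.subspace class_ring ?W V" and U: "VectorSpace.subspace class_ring ?U V"
    using cX cXY by (auto intro: span_is_subspace)
  show ?thesis
    unfolding rank_def
    using vectorspace.subspace_dim[OF subspace_is_vs[OF W] nested_subspaces[OF W U sub]]
      fin_dim_span_cols[OF X] fin_dim_span_cols[OF mult_carrier_mat[OF X Y]] by auto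
qed

lemma (in vec_space) rank_le_inner_dim:
  assumes "X \<in> carrier_mat n m" "Y \<in> carrier_mat m k"
  shows "rank (X * Y) \<le> m"
  using rank_mult_le_left[OF assms] rank_le_nc[OF assms(1)] by linarith

text \<open>The library speaks of linear dependence for the set of columns, which forgets
  repetitions. A matrix of full column rank has as many distinct columns as columns, so nothing is
  lost and a nonzero kernel vector would be a dependence between them.\<close>

lemma (in vec_space) full_column_rank_kernel:
  assumes A: "A \<in> carrier_mat n nc" and full: "rank A = nc"
    and v: "v \<in> carrier_vec nc" and Av: "A *\<^sub>v v = 0\<^sub>v n"
  shows "v = 0\<^sub>v nc"
proof (rule ccontr)
  assume "v \<noteq> 0\<^sub>v nc"
  obtain S where S: "maximal S (\<lambda>T. T \<subseteq> set (cols A) \<and> lin_indpt T)"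
    using maximal_exists_superset[of "set (cols A)" "\<lambda>T. T \<subseteq> set (cols A) \<and> lin_indpt T" "{}"]
      lindep_span finite_lin_indpt2[of "{}"] by auto
  hence "nc \<le> card (set (cols A))"
    using full rank_card_indpt[OF A S] card_mono[of "set (cols A)" S] by (auto simp: maximal_def)
  hence "distinct (cols A)"
    using A card_length[of "cols A"] by (intro card_distinct) auto
  thus False
    using lin_depI[OF A v \<open>v \<noteq> 0\<^sub>v nc\<close> Av] full_rank_lin_indpt[OF A full] by blast
qed

text \<open>A kernel vector of \<open>N\<close> would also be one of \<open>P\<^sup>T N\<close>, although the rank of that matrix, being
  at least that of \<open>P\<^sup>T N P\<close>, equals its number of columns.\<close>

lemma det_nonzero_of_congruence:
  fixes N P :: "real mat"
  assumes N: "N \<in> carrier_mat r r" and P: "P \<in> carrier_mat r n"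
    and rank: "vec_space.rank n (P\<^sup>T * N * P) = r"
  shows "det N \<noteq> 0"
proof
  interpret vec_space "TYPE(real)" n .
  assume "det N = 0"
  then obtain v where v: "v \<in> carrier_vec r" "v \<noteq> 0\<^sub>v r" "N *\<^sub>v v = 0\<^sub>v r"
    using det_0_iff_vec_prod_zero_field[OF N] by blast
  have PN: "P\<^sup>T * N \<in> carrier_mat n r"
    using N P by simp
  have "rank (P\<^sup>T * N) = r"
    using rank_mult_le_left[OF PN P] rank_le_nc[OF PN] rank by linarith
  moreover have "(P\<^sup>T * N) *\<^sub>v v = 0\<^sub>v n"
    using v N P by (subst assoc_mult_mat_vec) (auto intro!: eq_vecI)
  ultimately show False
    using full_column_rank_kernel[OF PN _ v(1)] v(2) by blast
qed

section \<open>Doubly nonnegative matrices of order three\<close>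

lemma binary_form_nonneg:
  fixes a b h :: real
  assumes form: "\<And>s t. 0 \<le> a * s\<^sup>2 + 2 * h * s * t + b * t\<^sup>2"
  shows "0 \<le> a" "0 \<le> b" "h\<^sup>2 \<le> a * b"
proof -
  show a: "0 \<le> a" and "0 \<le> b"
    using form[of 1 0] form[of 0 1] by simp_all
  show "h\<^sup>2 \<le> a * b"
  proof (cases "a = 0")
    case True
    have "h = 0"
    proof (rule ccontr)
      assume "h \<noteq> 0"
      thus False
        \<comment> \<open>With \<open>a = 0\<close> the form is linear in \<open>s\<close>; at this point its value is \<open>- 1\<close>.\<close>
        using form[of "- (b + 1) / (2 * h)" 1] True by simp
    qed
    thus ?thesis
      using True by simp
  next
    case False
    have "0 \<le> a * (a * b - h\<^sup>2)"
      using form[of "- h" a] by (simp add: algebra_simps power2_eq_square)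
    thus ?thesis
      using a False by (simp add: zero_le_mult_iff)
  qed
qed

text \<open>A Cholesky factorization: \<open>q = f / p\<close> is nonnegative with \<open>f\<close>. In the singular case \<open>b = 0\<close>
  also \<open>f = 0\<close>, and \<open>x / 0 = 0\<close> gives the right value \<open>q = 0\<close>.\<close>

lemma binary_dnn_factor:
  fixes b c f :: real
  assumes form: "\<And>s t. 0 \<le> b * s\<^sup>2 + 2 * f * s * t + c * t\<^sup>2" and f: "0 \<le> f"
  obtains p q r where "0 \<le> p" "0 \<le> q" "0 \<le> r" "p * p = b" "p * q = f" "q * q + r * r = c"
proof -
  note psd = binary_form_nonneg[OF form]
  let ?p = "sqrt b" and ?q = "f / sqrt b"
  have pq: "?p * ?q = f"
    using psd by (cases "b = 0") auto
  have "f\<^sup>2 / b \<le> c"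
    using psd by (cases "b = 0") (auto simp: field_simps)
  hence "?q * ?q + sqrt (c - f\<^sup>2 / b) * sqrt (c - f\<^sup>2 / b) = c"
    using psd by (simp add: power2_eq_square)
  thus thesis
    using that[of ?p ?q "sqrt (c - f\<^sup>2 / b)"] pq psd f \<open>f\<^sup>2 / b \<le> c\<close> by simp
qed

definition dot3 :: "(nat \<Rightarrow> real) \<Rightarrow> (nat \<Rightarrow> real) \<Rightarrow> real" where
  "dot3 x y = x 0 * y 0 + x 1 * y 1 + x 2 * y 2"

text \<open>The Gram matrix of \<open>x\<close>, \<open>y\<close>, \<open>z\<close> has the diagonal \<open>a\<close>, \<open>b\<close>, \<open>c\<close> and above it the entries
  \<open>d\<close>, \<open>e\<close> and \<open>f\<close>. Six scalars instead of a matrix make it cheap to permute the three vectors.\<close>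

definition nonneg_gram3 :: "real \<Rightarrow> real \<Rightarrow> real \<Rightarrow> real \<Rightarrow> real \<Rightarrow> real \<Rightarrow> bool" where
  "nonneg_gram3 a b c d e f \<longleftrightarrow> (\<exists>x y z. (\<forall>l. 0 \<le> x l \<and> 0 \<le> y l \<and> 0 \<le> z l) \<and>
     dot3 x x = a \<and> dot3 y y = b \<and> dot3 z z = c \<and> dot3 x y = d \<and> dot3 x z = e \<and> dot3 y z = f)"

lemma nonneg_gram3_swap12: "nonneg_gram3 b a c d f e \<Longrightarrow> nonneg_gram3 a b c d e f"
  unfolding nonneg_gram3_def dot3_def by (metis mult.commute)

lemma nonneg_gram3_swap13: "nonneg_gram3 c b a f e d \<Longrightarrow> nonneg_gram3 a b c d e f"
  unfolding nonneg_gram3_def dot3_def by (metis mult.commute)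

text \<open>Elimination at the first diagonal entry. The Schur complement is again positive semidefinite,
  and the pivot condition says that its off-diagonal entry \<open>f - d e / a\<close> is nonnegative, so that
  the binary case factors it. If \<open>a = 0\<close> then \<open>d = e = 0\<close>, and the same formulas hold because
  \<open>x / 0 = 0\<close>.\<close>

lemma nonneg_gram3_pivot:
  fixes a b c d e f :: real
  assumes form: "\<And>x y z. 0 \<le> a * x\<^sup>2 + b * y\<^sup>2 + c * z\<^sup>2 + 2 * d * x * y + 2 * e * x * z + 2 * f * y * z"
    and nonneg: "0 \<le> d" "0 \<le> e" and pivot: "d * e \<le> a * f" and f: "0 \<le> f"
  shows "nonneg_gram3 a b c d e f"
proof -
  have a: "0 \<le> a" and "d\<^sup>2 \<le> a * b"
    using binary_form_nonneg[of a d b] form[of _ _ 0] by (simp_all add: algebra_simps)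
  moreover have "e\<^sup>2 \<le> a * c"
    using binary_form_nonneg[of a e c] form[of _ 0] by (simp add: algebra_simps)
  ultimately have zero: "d = 0 \<and> e = 0" if "a = 0"
    using that by simp
  have schur: "0 \<le> (b - d\<^sup>2 / a) * s\<^sup>2 + 2 * (f - d * e / a) * s * t + (c - e\<^sup>2 / a) * t\<^sup>2" for s t
  proof (cases "a = 0")
    case True
    thus ?thesis
      using zero form[of 0 s t] by (simp add: algebra_simps)
  next
    case False
    \<comment> \<open>The Schur complement is the minimum of the form over the first variable, attained here.\<close>
    let ?x = "- (d * s + e * t) / a"
    have "a * ?x\<^sup>2 + b * s\<^sup>2 + c * t\<^sup>2 + 2 * d * ?x * s + 2 * e * ?x * t + 2 * f * s * t
        = (b - d\<^sup>2 / a) * s\<^sup>2 + 2 * (f - d * e / a) * s * t + (c - e\<^sup>2 / a) * t\<^sup>2"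
      using False by (simp add: field_simps power2_eq_square)
    thus ?thesis
      using form[of ?x s t] by simp
  qed
  have "0 \<le> f - d * e / a"
    using a pivot f by (cases "a = 0") (auto simp: field_simps)
  then obtain p q r where pqr: "0 \<le> p" "0 \<le> q" "0 \<le> r" "p * p = b - d\<^sup>2 / a"
      "p * q = f - d * e / a" "q * q + r * r = c - e\<^sup>2 / a"
    using binary_dnn_factor[OF schur] by blast
  define x y z where "x = (\<lambda>l::nat. if l = 0 then sqrt a else 0)"
    and "y = (\<lambda>l::nat. if l = 0 then d / sqrt a else if l = 1 then p else 0)"
    and "z = (\<lambda>l::nat. if l = 0 then e / sqrt a else if l = 1 then q else r)"
  have "\<forall>l. 0 \<le> x l \<and> 0 \<le> y l \<and> 0 \<le> z l"
    using a nonneg pqr by (simp add: x_def y_def z_def)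
  moreover have "dot3 x x = a" "dot3 y y = b" "dot3 z z = c" "dot3 y z = f"
    using a pqr by (simp_all add: dot3_def x_def y_def z_def power2_eq_square)
  moreover have "dot3 x y = d" "dot3 x z = e"
    using zero a by (cases "a = 0"; simp add: dot3_def x_def y_def z_def)+
  ultimately show ?thesis
    unfolding nonneg_gram3_def by blast
qed

text \<open>At least one of the three diagonal entries is a possible pivot. If the first two both failed,
  multiplying \<open>a f < d e\<close> and \<open>b e < d f\<close> would give \<open>a b < d\<^sup>2\<close>, against the sign of the
  principal minor of order two.\<close>

lemma ternary_dnn_gram:
  fixes a b c d e f :: real
  assumes form: "\<And>x y z. 0 \<le> a * x\<^sup>2 + b * y\<^sup>2 + c * z\<^sup>2 + 2 * d * x * y + 2 * e * x * z + 2 * f * y * z"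
    and nonneg: "0 \<le> d" "0 \<le> e" "0 \<le> f"
  shows "nonneg_gram3 a b c d e f"
proof -
  consider "d * e \<le> a * f" | "d * f \<le> b * e" | "f * e \<le> c * d"
  proof (rule ccontr)
    assume "\<not> thesis"
    hence less: "a * f < d * e" "b * e < d * f" "c * d < f * e"
      using that by force+
    have diag: "0 \<le> a" "0 \<le> b" "d\<^sup>2 \<le> a * b"
      using binary_form_nonneg[of a d b] form[of _ _ 0] by (simp_all add: algebra_simps)
    have "(a * f) * (b * e) < (d * e) * (d * f)"
      using mult_strict_mono'[OF less(1,2)] diag nonneg by simp
    hence "(a * b) * (e * f) < d\<^sup>2 * (e * f)"
      by (simp add: algebra_simps power2_eq_square)
    moreover have "d\<^sup>2 * (e * f) \<le> (a * b) * (e * f)"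
      using diag nonneg by (intro mult_right_mono) auto
    ultimately show False
      by simp
  qed
  thus ?thesis
  proof cases
    case 1
    show ?thesis
      by (rule nonneg_gram3_pivot[OF form nonneg(1,2) 1 nonneg(3)])
  next
    case 2
    have "0 \<le> b * x\<^sup>2 + a * y\<^sup>2 + c * z\<^sup>2 + 2 * d * x * y + 2 * f * x * z + 2 * e * y * z" for x y z
      using form[of y x z] by (simp add: algebra_simps)
    hence "nonneg_gram3 b a c d f e"
      by (rule nonneg_gram3_pivot[OF _ nonneg(1,3) 2 nonneg(2)])
    thus ?thesis
      by (rule nonneg_gram3_swap12)
  next
    case 3
    have "0 \<le> c * x\<^sup>2 + b * y\<^sup>2 + a * z\<^sup>2 + 2 * f * x * y + 2 * e * x * z + 2 * d * y * z" for x y z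
      using form[of z y x] by (simp add: algebra_simps)
    hence "nonneg_gram3 c b a f e d"
      by (rule nonneg_gram3_pivot[OF _ nonneg(3,2) 3 nonneg(1)])
    thus ?thesis
      by (rule nonneg_gram3_swap13)
  qed
qed

lemma less_3_cases: "i < (3::nat) \<longleftrightarrow> i = 0 \<or> i = 1 \<or> i = 2"
  by auto

lemma dnn_order_3_factor:
  assumes N: "N \<in> carrier_mat 3 3" and psd: "pos_semidef N" and nonneg: "nonneg_matrix N"
  obtains B where "B \<in> carrier_mat 3 3" "nonneg_matrix B" "N = B\<^sup>T * B"
proof -
  have set3: "{0..<3} = {0, 1, 2::nat}"
    by auto
  have "N\<^sup>T = N"
    using psd by (simp add: pos_semidef_def symmetric_matrix_def)
  hence sym: "N $$ (i, j) = N $$ (j, i)" if "i < 3" "j < 3" for i j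
    using that N by (metis carrier_matD index_transpose_mat(1))
  have entry: "0 \<le> N $$ (i, j)" if "i < 3" "j < 3" for i j
    using that N nonneg by (auto simp: nonneg_matrix_def less_eq_mat_def)
  have form: "0 \<le> N $$ (0,0) * x\<^sup>2 + N $$ (1,1) * y\<^sup>2 + N $$ (2,2) * z\<^sup>2
      + 2 * N $$ (0,1) * x * y + 2 * N $$ (0,2) * x * z + 2 * N $$ (1,2) * y * z" for x y z
  proof -
    let ?v = "vec 3 (\<lambda>i. if i = 0 then x else if i = 1 then y else z)"
    have "0 \<le> ?v \<bullet> (N *\<^sub>v ?v)"
      using psd N by (simp add: pos_semidef_def)
    also have "\<dots> = N $$ (0,0) * x\<^sup>2 + N $$ (1,1) * y\<^sup>2 + N $$ (2,2) * z\<^sup>2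
      + 2 * N $$ (0,1) * x * y + 2 * N $$ (0,2) * x * z + 2 * N $$ (1,2) * y * z"
      using N sym[of 1 0] sym[of 2 0] sym[of 2 1]
      by (simp add: scalar_prod_def set3 algebra_simps power2_eq_square)
    finally show ?thesis .
  qed
  obtain x y z :: "nat \<Rightarrow> real" where xyz: "\<forall>l. 0 \<le> x l \<and> 0 \<le> y l \<and> 0 \<le> z l"
      "dot3 x x = N $$ (0,0)" "dot3 y y = N $$ (1,1)" "dot3 z z = N $$ (2,2)"
      "dot3 x y = N $$ (0,1)" "dot3 x z = N $$ (0,2)" "dot3 y z = N $$ (1,2)"
    using ternary_dnn_gram[OF form] entry by (auto simp: nonneg_gram3_def)
  define B where "B = mat 3 3 (\<lambda>(l, i). if i = 0 then x l else if i = 1 then y l else z l)"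
  have B: "B \<in> carrier_mat 3 3"
    by (simp add: B_def)
  have "N = B\<^sup>T * B"
  proof (rule eq_matI)
    fix i j assume "i < dim_row (B\<^sup>T * B)" "j < dim_col (B\<^sup>T * B)"
    hence "i = 0 \<or> i = 1 \<or> i = 2" "j = 0 \<or> j = 1 \<or> j = 2"
      using B by (auto simp: less_3_cases)
    thus "N $$ (i, j) = (B\<^sup>T * B) $$ (i, j)"
      using xyz(2-)[symmetric] sym[of 1 0] sym[of 2 0] sym[of 2 1]
      by (elim disjE) (simp_all add: B_def scalar_prod_def set3 dot3_def mult.commute)
  qed (use N B in auto)
  moreover have "nonneg_matrix B"
    using xyz(1) by (auto simp: nonneg_matrix_def less_eq_mat_def B_def)
  ultimately show thesis
    using B that by blast
qed

section \<open>Columns that span extreme rays\<close>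

text \<open>A cone contains all combinations of its generators, so only the columns of \<open>A\<close> themselves have
  to be represented; the entrywise form reduces this to sums of scalars.\<close>

definition generating_columns :: "real mat \<Rightarrow> nat set \<Rightarrow> bool" where
  "generating_columns A S \<longleftrightarrow> S \<subseteq> {..<dim_col A} \<and>
     (\<forall>k < dim_col A. \<exists>c. (\<forall>j. 0 \<le> c j) \<and>
        (\<forall>i < dim_row A. A $$ (i, k) = (\<Sum>j\<in>S. c j * A $$ (i, j))))"

definition minimal_generating_columns :: "real mat \<Rightarrow> nat set \<Rightarrow> bool" where
  "minimal_generating_columns A S \<longleftrightarrow>
     generating_columns A S \<and> (\<forall>T. generating_columns A T \<longrightarrow> card S \<le> card T)"

lemma generating_columns_finite: "generating_columns A S \<Longrightarrow> finite S"
  unfolding generating_columns_def using finite_subset by blast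

lemma minimal_generating_columnsD:
  assumes "minimal_generating_columns A S"
  shows "generating_columns A S" "finite S" "S \<subseteq> {..<dim_col A}"
  using assms generating_columns_finite
  unfolding minimal_generating_columns_def by (blast, blast, simp add: generating_columns_def)

lemma minimal_generating_columns_exists: "\<exists>S. minimal_generating_columns A S"
proof -
  have "generating_columns A {..<dim_col A}"
    unfolding generating_columns_def
  proof (intro conjI allI impI)
    fix k assume "k < dim_col A"
    thus "\<exists>c. (\<forall>j. 0 \<le> c j) \<and>
        (\<forall>i<dim_row A. A $$ (i, k) = (\<Sum>j<dim_col A. c j * A $$ (i, j)))"
      by (intro exI[of _ "\<lambda>j. if j = k then 1 else 0"]) (auto simp: if_distrib[of "\<lambda>x. x * _"] sum.delta cong: if_cong)
  qed simp
  thus ?thesis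
    unfolding minimal_generating_columns_def
    using ex_has_least_nat[of "generating_columns A" _ card] by blast
qed

lemma generating_columns_remove:
  assumes gen: "generating_columns A S" and j: "j \<in> S"
    and d: "\<And>l. 0 \<le> d l" "\<And>i. i < dim_row A \<Longrightarrow> A $$ (i, j) = (\<Sum>l\<in>S - {j}. d l * A $$ (i, l))"
  shows "generating_columns A (S - {j})"
  unfolding generating_columns_def
proof (intro conjI allI impI)
  show "S - {j} \<subseteq> {..<dim_col A}"
    using gen by (auto simp: generating_columns_def)
  fix k assume "k < dim_col A"
  then obtain c where c: "\<And>l. 0 \<le> c l"
      "\<And>i. i < dim_row A \<Longrightarrow> A $$ (i, k) = (\<Sum>l\<in>S. c l * A $$ (i, l))"
    using gen unfolding generating_columns_def by metis
  have "A $$ (i, k) = (\<Sum>l\<in>S - {j}. (c l + c j * d l) * A $$ (i, l))" if "i < dim_row A" for i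
  proof -
    have "A $$ (i, k) = c j * A $$ (i, j) + (\<Sum>l\<in>S - {j}. c l * A $$ (i, l))"
      using c(2)[OF that] sum.remove[OF generating_columns_finite[OF gen] j] by simp
    also have "\<dots> = (\<Sum>l\<in>S - {j}. (c l + c j * d l) * A $$ (i, l))"
      unfolding d(2)[OF that] by (simp add: sum_distrib_left sum.distrib algebra_simps)
    finally show ?thesis .
  qed
  thus "\<exists>c. (\<forall>l. 0 \<le> c l) \<and> (\<forall>i<dim_row A. A $$ (i, k) = (\<Sum>l\<in>S - {j}. c l * A $$ (i, l)))"
    using c(1) d(1) by (intro exI[of _ "\<lambda>l. c l + c j * d l"]) simp
qed

text \<open>If \<open>t\<close> were positive, dividing by it would express column \<open>j\<close> by the other generators, and
  \<open>j\<close> could be dropped. That minimal generators are nonzero, span distinct rays and span extreme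
  rays all comes from this.\<close>

lemma minimal_generating_columns_irredundant:
  assumes min: "minimal_generating_columns A S" and j: "j \<in> S" and d: "\<And>l. 0 \<le> d l"
    and eq: "\<And>i. i < dim_row A \<Longrightarrow> t * A $$ (i, j) = (\<Sum>l\<in>S - {j}. d l * A $$ (i, l))"
  shows "t \<le> 0"
proof (rule ccontr)
  assume "\<not> t \<le> 0"
  hence t: "0 < t"
    by simp
  have "A $$ (i, j) = (\<Sum>l\<in>S - {j}. (d l / t) * A $$ (i, l))" if "i < dim_row A" for i
    using eq[OF that] t by (simp add: field_simps flip: sum_divide_distrib)
  hence "generating_columns A (S - {j})"
    using min j d t
    by (intro generating_columns_remove[of A S j "\<lambda>l. d l / t"])
      (auto simp: minimal_generating_columns_def)
  hence "card S \<le> card (S - {j})"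
    using min by (simp add: minimal_generating_columns_def)
  moreover have "finite S"
    using minimal_generating_columnsD[OF min] by simp
  ultimately show False
    using j card_Diff1_less[of S j] by simp
qed

lemma column_cone_coefficients:
  assumes gen: "generating_columns A S" and y: "y \<in> column_cone A"
  obtains c where "\<And>j. 0 \<le> c j"
    "\<And>i. i < dim_row A \<Longrightarrow> y $ i = (\<Sum>j\<in>S. c j * A $$ (i, j))"
proof -
  obtain x where x: "x \<in> carrier_vec (dim_col A)" "0\<^sub>v (dim_col A) \<le> x" "y = A *\<^sub>v x"
    using y by (auto simp: column_cone_def)
  have "\<forall>k. \<exists>c. k < dim_col A \<longrightarrow> (\<forall>j. 0 \<le> c j) \<and>
      (\<forall>i < dim_row A. A $$ (i, k) = (\<Sum>j\<in>S. c j * A $$ (i, j)))"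
    using gen by (auto simp: generating_columns_def)
  then obtain C where C: "\<And>k j. k < dim_col A \<Longrightarrow> 0 \<le> C k j"
      "\<And>k i. k < dim_col A \<Longrightarrow> i < dim_row A \<Longrightarrow> A $$ (i, k) = (\<Sum>j\<in>S. C k j * A $$ (i, j))"
    by metis
  show thesis
  proof (rule that[of "\<lambda>j. \<Sum>k<dim_col A. x $ k * C k j"])
    show "0 \<le> (\<Sum>k<dim_col A. x $ k * C k j)" for j
      using x C(1) by (intro sum_nonneg mult_nonneg_nonneg) (auto simp: less_eq_vec_def)
    fix i assume i: "i < dim_row A"
    have "y $ i = (\<Sum>k<dim_col A. A $$ (i, k) * x $ k)"
      using x i by (auto simp: scalar_prod_def atLeast0LessThan intro!: sum.cong)
    also have "\<dots> = (\<Sum>k<dim_col A. \<Sum>j\<in>S. x $ k * C k j * A $$ (i, j))"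
      using C(2) i by (intro sum.cong) (simp_all add: sum_distrib_left sum_distrib_right mult_ac)
    also have "\<dots> = (\<Sum>j\<in>S. (\<Sum>k<dim_col A. x $ k * C k j) * A $$ (i, j))"
      by (subst sum.swap) (simp add: sum_distrib_right)
    finally show "y $ i = (\<Sum>j\<in>S. (\<Sum>k<dim_col A. x $ k * C k j) * A $$ (i, j))" .
  qed
qed

lemma column_cone_dim: "y \<in> column_cone A \<Longrightarrow> dim_vec y = dim_row A"
  by (auto simp: column_cone_def)

lemma column_ray_subset_cone:
  assumes "j < dim_col A"
  shows "ray (col A j) \<subseteq> column_cone A"
proof
  fix v assume "v \<in> ray (col A j)"
  then obtain t where t: "0 \<le> t" "v = t \<cdot>\<^sub>v col A j"
    by (auto simp: ray_def)
  let ?x = "t \<cdot>\<^sub>v unit_vec (dim_col A) j"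
  have "A *\<^sub>v unit_vec (dim_col A) j = col A j"
    using assms by (intro eq_vecI) auto
  hence "v = A *\<^sub>v ?x"
    using t by (simp add: mult_mat_vec[of A "dim_row A" "dim_col A"])
  moreover have "0\<^sub>v (dim_col A) \<le> ?x"
    using t by (auto simp: less_eq_vec_def unit_vec_def)
  ultimately show "v \<in> column_cone A"
    unfolding column_cone_def by auto
qed

text \<open>Let \<open>y + z\<close> be \<open>s\<close> times column \<open>j\<close>, and write \<open>y\<close> and \<open>z\<close> in the generators with
  coefficients \<open>c\<close> and \<open>d\<close>. Collecting the \<open>j\<close>-terms leaves \<open>s - c j - d j\<close> times column \<open>j\<close> on
  one side and a nonnegative combination of the other columns on the other. Minimality makes that
  factor nonpositive; since the entries of \<open>A\<close> are nonnegative, both sides vanish, term by term,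
  and only the \<open>j\<close>-terms of \<open>y\<close> and \<open>z\<close> remain.\<close>

lemma minimal_column_extreme:
  assumes nonneg: "nonneg_matrix A" and min: "minimal_generating_columns A S" and j: "j \<in> S"
  shows "ray (col A j) \<in> Extr (column_cone A)"
proof -
  have gen: "generating_columns A S" and fin: "finite S" and jdim: "j < dim_col A"
    using minimal_generating_columnsD[OF min] j by auto
  have entry: "0 \<le> A $$ (i, l)" if "i < dim_row A" "l \<in> S" for i l
    using nonneg gen that by (auto simp: nonneg_matrix_def less_eq_mat_def generating_columns_def)
  have "col A j \<noteq> 0\<^sub>v (dim_row A)"
  proof
    assume zero: "col A j = 0\<^sub>v (dim_row A)"
    have "A $$ (i, j) = 0" if "i < dim_row A" for i
      using that jdim zero by (metis index_col index_zero_vec(1))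
    thus False
      using minimal_generating_columns_irredundant[OF min j, of "\<lambda>_. 0" 1] by simp
  qed
  moreover have "y \<in> ray (col A j) \<and> z \<in> ray (col A j)"
    if y: "y \<in> column_cone A" and z: "z \<in> column_cone A" and yz: "y + z \<in> ray (col A j)" for y z
  proof -
    obtain s where s: "0 \<le> s" "y + z = s \<cdot>\<^sub>v col A j"
      using yz by (auto simp: ray_def)
    obtain c where c: "\<And>l. 0 \<le> c l" "\<And>i. i < dim_row A \<Longrightarrow> y $ i = (\<Sum>l\<in>S. c l * A $$ (i, l))"
      using column_cone_coefficients[OF gen y] by blast
    obtain d where d: "\<And>l. 0 \<le> d l" "\<And>i. i < dim_row A \<Longrightarrow> z $ i = (\<Sum>l\<in>S. d l * A $$ (i, l))"
      using column_cone_coefficients[OF gen z] by blast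
    note dims = column_cone_dim[OF y] column_cone_dim[OF z]
    have rest: "(s - c j - d j) * A $$ (i, j) = (\<Sum>l\<in>S - {j}. (c l + d l) * A $$ (i, l))"
      if i: "i < dim_row A" for i
    proof -
      have "s * A $$ (i, j) = y $ i + z $ i"
        using arg_cong[OF s(2), of "\<lambda>v. v $ i"] i jdim dims by simp
      also have "\<dots> = (\<Sum>l\<in>S. (c l + d l) * A $$ (i, l))"
        using c(2)[OF i] d(2)[OF i] by (simp add: sum.distrib algebra_simps)
      finally show ?thesis
        using sum.remove[OF fin j, of "\<lambda>l. (c l + d l) * A $$ (i, l)"] by (simp add: algebra_simps)
    qed
    have "s - c j - d j \<le> 0"
      by (rule minimal_generating_columns_irredundant[OF min j _ rest]) (simp_all add: c d)
    hence vanish: "(c l + d l) * A $$ (i, l) = 0" if i: "i < dim_row A" and l: "l \<in> S - {j}" for i l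
    proof -
      have terms: "0 \<le> (c l + d l) * A $$ (i, l)" if "l \<in> S - {j}" for l
        using that entry[OF i] c d by simp
      have "(\<Sum>l\<in>S - {j}. (c l + d l) * A $$ (i, l)) \<le> 0"
        unfolding rest[OF i, symmetric] using \<open>s - c j - d j \<le> 0\<close> entry[OF i j]
        by (rule mult_nonpos_nonneg)
      hence "(\<Sum>l\<in>S - {j}. (c l + d l) * A $$ (i, l)) = 0"
        using sum_nonneg[of "S - {j}" "\<lambda>l. (c l + d l) * A $$ (i, l)"] terms by fastforce
      thus ?thesis
        using sum_nonneg_eq_0_iff[of "S - {j}" "\<lambda>l. (c l + d l) * A $$ (i, l)"] fin terms l by blast
    qed
    have single: "v = b j \<cdot>\<^sub>v col A j"
      if b: "\<And>l. 0 \<le> b l" "\<And>l. b l \<le> c l + d l" and dim: "dim_vec v = dim_row A"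
        and v: "\<And>i. i < dim_row A \<Longrightarrow> v $ i = (\<Sum>l\<in>S. b l * A $$ (i, l))" for b v
    proof (rule eq_vecI)
      fix i assume "i < dim_vec (b j \<cdot>\<^sub>v col A j)"
      hence i: "i < dim_row A"
        by simp
      have "b l * A $$ (i, l) = 0" if "l \<in> S - {j}" for l
        using vanish[OF i that] b[of l] by auto
      hence "v $ i = b j * A $$ (i, j)"
        unfolding v[OF i] sum.remove[OF fin j] by (simp add: sum.neutral del: mult_eq_0_iff)
      thus "v $ i = (b j \<cdot>\<^sub>v col A j) $ i"
        using i jdim by simp
    qed (use dim in simp)
    have "y = c j \<cdot>\<^sub>v col A j" "z = d j \<cdot>\<^sub>v col A j"
      using c d dims by (auto intro: single)
    thus ?thesis
      using c(1) d(1) by (auto simp: ray_def)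
  qed
  ultimately show ?thesis
    using column_ray_subset_cone[OF jdim] unfolding Extr_def
    by (intro CollectI conjI exI[of _ "col A j"]) auto
qed

lemma minimal_columns_distinct_rays:
  assumes min: "minimal_generating_columns A S"
  shows "inj_on (\<lambda>j. ray (col A j)) S"
proof (rule inj_onI, rule ccontr)
  fix j k assume j: "j \<in> S" and k: "k \<in> S" and eq: "ray (col A j) = ray (col A k)" and "j \<noteq> k"
  have fin: "finite S" and dim: "j < dim_col A" "k < dim_col A"
    using minimal_generating_columnsD[OF min] j k by auto
  have "col A j \<in> ray (col A j)"
    unfolding ray_def by (rule CollectI, rule exI[of _ 1]) simp
  then obtain t where t: "0 \<le> t" "col A j = t \<cdot>\<^sub>v col A k"
    unfolding eq by (auto simp: ray_def)
  have "1 * A $$ (i, j) = (\<Sum>l\<in>S - {j}. (if l = k then t else 0) * A $$ (i, l))" if i: "i < dim_row A" for i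
  proof -
    have "A $$ (i, j) = t * A $$ (i, k)"
      using arg_cong[OF t(2), of "\<lambda>v. v $ i"] i dim by simp
    thus ?thesis
      using fin k \<open>j \<noteq> k\<close> by (simp add: if_distrib[of "\<lambda>x. x * _"] sum.delta cong: if_cong)
  qed
  hence "(1::real) \<le> 0"
    by (rule minimal_generating_columns_irredundant[OF min j, rotated]) (use t(1) in auto)
  thus False
    by simp
qed

text \<open>A minimal generating set injects into the extreme rays, so it has at most \<open>rank A\<close> elements;
  and a factorization through its columns shows that it has at least as many.\<close>

lemma simplicial_column_factorization:
  assumes A: "A \<in> carrier_mat m n" and nonneg: "nonneg_matrix A"
    and finite_extr: "finite (Extr (column_cone A))"
    and card: "card (Extr (column_cone A)) = vec_space.rank m A"
  obtains J P where "J \<subseteq> {..<n}" "card J = vec_space.rank m A"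
    "P \<in> carrier_mat (card J) n" "nonneg_matrix P" "A = submatrix A UNIV J * P"
proof -
  interpret vec_space "TYPE(real)" m .
  obtain J where min: "minimal_generating_columns A J"
    using minimal_generating_columns_exists by blast
  have gen: "generating_columns A J" and finJ: "finite J" and J: "J \<subseteq> {..<n}"
    using minimal_generating_columnsD[OF min] A by auto
  have "card J = card ((\<lambda>j. ray (col A j)) ` J)"
    using minimal_columns_distinct_rays[OF min] by (simp add: card_image)
  also have "\<dots> \<le> rank A"
    unfolding card[symmetric] using minimal_column_extreme[OF nonneg min] finite_extr
    by (intro card_mono) auto
  finally have le: "card J \<le> rank A" .
  have "\<forall>k. \<exists>c. k < n \<longrightarrow> (\<forall>j. 0 \<le> c j) \<and>
      (\<forall>i < m. A $$ (i, k) = (\<Sum>j\<in>J. c j * A $$ (i, j)))"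
    using gen A by (auto simp: generating_columns_def)
  then obtain C where C: "\<And>k j. k < n \<Longrightarrow> 0 \<le> C k j"
      "\<And>k i. k < n \<Longrightarrow> i < m \<Longrightarrow> A $$ (i, k) = (\<Sum>j\<in>J. C k j * A $$ (i, j))"
    by metis
  define P where "P = mat (card J) n (\<lambda>(l, k). C k (pick J l))"
  have P: "P \<in> carrier_mat (card J) n"
    by (simp add: P_def)
  have AJ: "submatrix A UNIV J \<in> carrier_mat m (card J)"
    using A by (auto simp: dim_submatrix selected_eq[OF J])
  have eq: "A = submatrix A UNIV J * P"
  proof (rule eq_matI)
    fix i k assume "i < dim_row (submatrix A UNIV J * P)" "k < dim_col (submatrix A UNIV J * P)"
    hence i: "i < m" and k: "k < n"
      using AJ P by auto
    have "A $$ (i, k) = (\<Sum>j\<in>J. C k j * A $$ (i, j))"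
      using C(2) i k by simp
    also have "\<dots> = (\<Sum>l<card J. C k (pick J l) * A $$ (i, pick J l))"
      using sum.reindex_bij_betw[OF bij_betw_pick[OF finJ], of "\<lambda>j. C k j * A $$ (i, j)"] by simp
    also have "\<dots> = (\<Sum>l<card J. submatrix A UNIV J $$ (i, l) * P $$ (l, k))"
      using A i k by (intro sum.cong) (auto simp: P_def submatrix_index selected_eq[OF J] pick_UNIV)
    also have "\<dots> = (submatrix A UNIV J * P) $$ (i, k)"
      using AJ P i k by (auto simp: scalar_prod_def atLeast0LessThan intro!: sum.cong)
    finally show "A $$ (i, k) = (submatrix A UNIV J * P) $$ (i, k)" .
  qed (use A AJ P in auto)
  have "nonneg_matrix P"
    using C(1) by (auto simp: nonneg_matrix_def less_eq_mat_def P_def)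
  moreover have "rank A \<le> card J"
    using rank_le_inner_dim[OF AJ P] eq by simp
  ultimately show thesis
    using that[OF J _ P _ eq] le by simp
qed

section \<open>Nonnegative equivalence and complete positivity\<close>

text \<open>The form of the submatrix at \<open>x\<close> is the form of \<open>A\<close> at \<open>x\<close> extended by zeros outside \<open>J\<close>.\<close>

lemma pos_semidef_principal_submatrix:
  assumes A: "A \<in> carrier_mat n n" and psd: "pos_semidef A" and J: "J \<subseteq> {..<n}"
  shows "pos_semidef (submatrix A J J)"
  unfolding pos_semidef_def
proof (intro conjI ballI)
  have fin: "finite J"
    using J finite_subset by blast
  have N: "submatrix A J J \<in> carrier_mat (card J) (card J)"
    using A by (auto simp: dim_submatrix selected_eq[OF J])
  show "symmetric_matrix (submatrix A J J)"
    using psd N by (auto simp: pos_semidef_def symmetric_matrix_def transpose_submatrix)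
  fix x :: "real vec"
  assume x: "x \<in> carrier_vec (dim_row (submatrix A J J))"
  define g where "g = the_inv_into {..<card J} (pick J)"
  define y where "y = vec n (\<lambda>i. if i \<in> J then x $ g i else 0)"
  have y: "y \<in> carrier_vec n"
    by (simp add: y_def)
  have g: "g (pick J l) = l" if "l < card J" for l
    using that bij_betw_pick[OF fin] by (simp add: g_def the_inv_into_f_f bij_betw_def)
  have y_pick: "y $ pick J l = x $ l" if "l < card J" for l
    using g[OF that] pick_in_set_le[OF that] J that by (auto simp: y_def)
  have reindex: "(\<Sum>i<n. y $ i * h i) = (\<Sum>l<card J. x $ l * h (pick J l))" for h
  proof -
    have "(\<Sum>i<n. y $ i * h i) = (\<Sum>i\<in>J. y $ i * h i)"
      by (rule sum.mono_neutral_right) (use J in \<open>auto simp: y_def\<close>)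
    also have "\<dots> = (\<Sum>l<card J. y $ pick J l * h (pick J l))"
      by (rule sum.reindex_bij_betw[OF bij_betw_pick[OF fin], symmetric])
    finally show ?thesis
      using y_pick by simp
  qed
  have "y \<bullet> (A *\<^sub>v y) = (\<Sum>i<n. y $ i * (\<Sum>k<n. y $ k * A $$ (i, k)))"
    using A y by (auto simp: scalar_prod_def atLeast0LessThan mult.commute intro!: sum.cong)
  also have "\<dots> = (\<Sum>l<card J. x $ l * (\<Sum>m<card J. x $ m * A $$ (pick J l, pick J m)))"
    by (simp only: reindex)
  also have "\<dots> = (\<Sum>l<card J. x $ l * (\<Sum>m<card J. x $ m * submatrix A J J $$ (l, m)))"
    using A by (simp add: submatrix_index selected_eq[OF J])
  also have "\<dots> = x \<bullet> (submatrix A J J *\<^sub>v x)"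
    using N x by (auto simp: scalar_prod_def atLeast0LessThan mult.commute intro!: sum.cong)
  finally show "0 \<le> x \<bullet> (submatrix A J J *\<^sub>v x)"
    using psd A y by (auto simp: pos_semidef_def)
qed

lemma nonneg_submatrix:
  "nonneg_matrix A \<Longrightarrow> nonneg_matrix (submatrix A I J)"
  by (auto simp: nonneg_matrix_def less_eq_mat_def submatrix_def pick_le)

lemma nonneg_mult:
  assumes "nonneg_matrix X" "nonneg_matrix Y" "dim_col X = dim_row Y"
  shows "nonneg_matrix (X * Y)"
  using assms
  by (auto simp: nonneg_matrix_def less_eq_mat_def scalar_prod_def intro!: sum_nonneg)

lemma rank_le_cp_factor:
  assumes "A \<in> carrier_mat n n" "cp_factor m A B"
  shows "mat_rank A \<le> m"
  using assms vec_space.rank_le_inner_dim[of "B\<^sup>T" n m B n] by (auto simp: cp_factor_def)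

lemma CP_of_full_rank_factor:
  assumes A: "A \<in> carrier_mat n n" and B: "cp_factor r A B" and rank: "mat_rank A = r"
  shows "A \<in> CP n r"
proof -
  have "cp_rank A = r"
    unfolding cp_rank_def
    using B rank_le_cp_factor[OF A] rank by (intro Least_equality) auto
  thus ?thesis
    using assms by (auto simp: CP_def completely_positive_def)
qed

lemma nnq_of_column_factorization:
  assumes A: "A \<in> carrier_mat n n" and sym: "symmetric_matrix A"
    and J: "J \<subseteq> {..<n}" and card: "card J = mat_rank A"
    and P: "P \<in> carrier_mat (card J) n" and nonneg: "nonneg_matrix P"
    and eq: "A = submatrix A UNIV J * P"
  shows "nnq A"
proof -
  let ?r = "card J" and ?N = "submatrix A J J" and ?B = "submatrix A J UNIV"
  have N: "?N \<in> carrier_mat ?r ?r" and B: "?B \<in> carrier_mat ?r n"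
    using A by (auto simp: dim_submatrix selected_eq[OF J])
  have AT: "A\<^sup>T = A"
    using sym by (simp add: symmetric_matrix_def)
  have B_eq: "?B = ?N * P" and A_eq: "A = P\<^sup>T * ?N * P"
    using gram_form_of_column_factorization[OF A AT P J eq] by blast+
  have "vec_space.rank n (P\<^sup>T * ?N * P) = ?r"
    using A card A_eq by simp
  hence det: "det ?N \<noteq> 0"
    by (rule det_nonzero_of_congruence[OF N P])
  then obtain C where C: "C \<in> carrier_mat ?r ?r" "?N * C = 1\<^sub>m ?r" "C * ?N = 1\<^sub>m ?r"
    using det_non_zero_imp_unit[OF N det, of undefined] by (auto simp: Units_def ring_mat_def)
  have minor: "submatrix ?B UNIV J = ?N"
    by (rule submatrix_rows_then_cols)
  have "mat_rank ?B = ?r"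
  proof (rule antisym)
    show "mat_rank ?B \<le> ?r"
      using vec_space.rank_le_inner_dim[OF N P] B unfolding B_eq[symmetric] by simp
    show "?r \<le> mat_rank ?B"
      using vec_space.rank_gt_minor[OF B, of UNIV J] det B minor
      by (simp add: selected_eq[OF J])
  qed
  moreover have "C * ?B = P"
    unfolding B_eq using C N P by (simp flip: assoc_mult_mat[of C ?r ?r ?N ?r P n])
  ultimately have "nnq_full_row_rank ?B"
    unfolding nnq_full_row_rank_def inverts_mat_def
    using B N J C nonneg by (intro conjI exI[of _ J] exI[of _ C]) (auto simp: minor)
  thus ?thesis
    unfolding nnq_def using sym A J card by auto
qed

theorem theorem3p11:
  fixes n :: nat and A :: "real mat"
  assumes "3 \<le> n"
    and "A \<in> DN n 3"
    and "card (Extr (column_cone A)) = 3"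
  shows "A \<in> CP n 3 \<longleftrightarrow> nnq A"
proof -
  have A: "A \<in> carrier_mat n n" and psd: "pos_semidef A" and nonneg: "nonneg_matrix A"
    and rank: "mat_rank A = 3"
    using assms(2) by (auto simp: DN_def)
  have sym: "symmetric_matrix A"
    using psd by (simp add: pos_semidef_def)
  have "finite (Extr (column_cone A))"
    using assms(3) by (intro card_ge_0_finite) simp
  moreover have "card (Extr (column_cone A)) = vec_space.rank n A"
    using assms(3) rank A by simp
  ultimately obtain J P where J: "J \<subseteq> {..<n}" and card: "card J = 3"
    and P: "P \<in> carrier_mat (card J) n" "nonneg_matrix P" and eq: "A = submatrix A UNIV J * P"
    using simplicial_column_factorization[OF A nonneg] rank A by (metis carrier_matD(1))
  have "nnq A"
    using nnq_of_column_factorization[OF A sym J _ P eq] card rank by simp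
  moreover have "A \<in> CP n 3"
  proof -
    let ?N = "submatrix A J J"
    have N: "?N \<in> carrier_mat 3 3"
      using A card by (auto simp: dim_submatrix selected_eq[OF J])
    obtain B where B: "B \<in> carrier_mat 3 3" "nonneg_matrix B" "?N = B\<^sup>T * B"
      using dnn_order_3_factor[OF N pos_semidef_principal_submatrix[OF A psd J] nonneg_submatrix[OF nonneg]]
      by blast
    have "A\<^sup>T = A"
      using sym by (simp add: symmetric_matrix_def)
    hence "A = P\<^sup>T * ?N * P"
      by (rule gram_form_of_column_factorization(2)[OF A _ P(1) J eq])
    also have "\<dots> = (B * P)\<^sup>T * (B * P)"
    proof -
      have P3: "P \<in> carrier_mat 3 n"
        using P(1) card by simp
      have "P\<^sup>T * (B\<^sup>T * B) * P = P\<^sup>T * B\<^sup>T * B * P"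
        using B(1) P3 by (simp add: assoc_mult_mat[of "P\<^sup>T" n 3 "B\<^sup>T" 3 B 3])
      also have "\<dots> = P\<^sup>T * B\<^sup>T * (B * P)"
        using B(1) P3 by (intro assoc_mult_mat) auto
      finally show ?thesis
        unfolding B(3) transpose_mult[OF B(1) P3] .
    qed
    finally have "cp_factor 3 A (B * P)"
      unfolding cp_factor_def using A B P card nonneg_mult[OF B(2) P(2)] by auto
    thus ?thesis
      by (rule CP_of_full_rank_factor[OF A _ rank])
  qed
  ultimately show ?thesis
    by simp
qed

end
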